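(* Let $n>2$ be an integer. Then the ring $\mathbb{T}_n(\mathbb{F}_2)$ is $n$-torsion clean if and only if $n=2^l$ for some integer $l\geq 2$.
   Context: $\mathbb{F}_2$ is the field with two elements and $\mathbb{T}_n(\mathbb{F}_2)$ is the ring of all upper triangular $n\times n$ matrices over $\mathbb{F}_2$. For a positive integer $m$, a ring $R$ with identity $1\neq 0$ is called almost $m$-torsion clean if for every $r\in R$ there exist a unit $u\in R$ with $u^m=1$ and an idempotent $e\in R$ (i.e. $e^2=e$) such that $r=u+e$. The ring $R$ is called $m$-torsion clean if it is almost $m$-torsion clean and $m$ is the smallest positive integer with this property (i.e. $R$ is not almost $m'$-torsion clean for any positive integer $m'<m$). *)

theory Defs
  imports "HOL-Algebra.Ring" "HOL-Library.Z2" "Jordan_Normal_Form.Matrix"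
begin

definition almost_torsion_clean :: "('a, 'b) ring_scheme \<Rightarrow> nat \<Rightarrow> bool" where
  "almost_torsion_clean R m \<longleftrightarrow>
     ring R \<and> \<one>\<^bsub>R\<^esub> \<noteq> \<zero>\<^bsub>R\<^esub> \<and> 0 < m \<and>
     (\<forall>r \<in> carrier R. \<exists>u \<in> Units R. \<exists>e \<in> carrier R.
        u [^]\<^bsub>R\<^esub> m = \<one>\<^bsub>R\<^esub> \<and> e \<otimes>\<^bsub>R\<^esub> e = e \<and> r = u \<oplus>\<^bsub>R\<^esub> e)"

definition torsion_clean :: "('a, 'b) ring_scheme \<Rightarrow> nat \<Rightarrow> bool" where
  "torsion_clean R m \<longleftrightarrow>
     almost_torsion_clean R m \<and> (\<forall>m'. 0 < m' \<and> m' < m \<longrightarrow> \<not> almost_torsion_clean R m')"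

definition upper_triangular_ring :: "'a :: comm_ring_1 itself \<Rightarrow> nat \<Rightarrow> 'a mat ring" where
  "upper_triangular_ring ty n =
     (ring_mat ty n ())\<lparr>carrier := {A \<in> carrier_mat n n. upper_triangular A}\<rparr>"

end

theory Submission
  imports Defs "HOL-Algebra.Multiplicative_Group" "HOL-Algebra.Subrings"
    "Jordan_Normal_Form.Jordan_Normal_Form"
begin

text \<open>
  The only invertible element of the field with two elements is \<open>1\<close>, so the units of the ring are exactly the unipotent matrices \<open>1 + N\<close> with \<open>N\<close> strictly upper
  triangular. Two facts then decide which exponents work.

  Every unit is killed by a power of two: in characteristic 2 one has
  \<open>(1 + N) ^ (2 ^ b) = 1 + N ^ (2 ^ b)\<close>, and \<open>N ^ (2 ^ b)\<close> vanishes once \<open>n \<le> 2 ^ b\<close>. Moreover every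
  upper triangular \<open>r\<close> is a unipotent matrix plus a diagonal idempotent, obtained by moving the
  zeros of the diagonal of \<open>r\<close> into the idempotent. Hence the ring is almost
  \<open>2 ^ b\<close>-torsion clean whenever \<open>n \<le> 2 ^ b\<close> (\<open>almost_torsion_clean_two_power\<close>).

  Conversely, the Jordan block \<open>J\<close> with eigenvalue 1 is a test element. In \<open>J = u + e\<close> the
  diagonals force \<open>e\<close> to be strictly upper triangular, hence nilpotent, hence (being idempotent)
  zero. So almost \<open>m\<close>-torsion cleanness implies \<open>J ^ m = 1\<close>. The order of \<open>J\<close> is some \<open>2 ^ i\<close>, which
  divides \<open>m\<close>. If \<open>2 ^ i < n\<close>, then \<open>J ^ (2 ^ i)\<close> would have the entry \<open>1\<close> at distance \<open>2 ^ i\<close> from the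
  diagonal and could not be the identity; hence \<open>n \<le> 2 ^ i\<close> (\<open>almost_torsion_clean_imp_two_power_dvd\<close>).

  For the exponent \<open>m = n\<close> this says \<open>2 ^ i dvd n \<le> 2 ^ i\<close>, so \<open>n\<close> is a power of two; and for every
  \<open>m\<close> it says \<open>n \<le> 2 ^ i \<le> m\<close>, which is minimality.
\<close>

section \<open>Units of finite order in rings\<close>

lemma (in monoid) Units_if_pow_eq_one:
  fixes m :: nat
  assumes "x \<in> carrier G" and "x [^] m = \<one>" and "0 < m"
  shows "x \<in> Units G"
proof -
  obtain k where k: "m = Suc k" using assms(3) by (cases m) auto
  have "x [^] k \<otimes> x = \<one>" using assms(2) by (simp add: k)
  moreover have "x \<otimes> x [^] k = \<one>"
    using assms(1,2) nat_pow_Suc2[of x k] by (simp add: k)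
  ultimately show ?thesis using assms(1) by (auto simp: Units_def)
qed

text \<open>
  The order of \<open>x\<close> divides \<open>p ^ k\<close>, so it is itself a power of \<open>p\<close>; this power is the witness.
\<close>
lemma (in monoid) common_pow_eq_one_prime_power:
  fixes p m k :: nat
  assumes x: "x \<in> carrier G" and p: "prime p"
    and m: "x [^] m = \<one>" and pk: "x [^] (p ^ k) = \<one>"
  shows "\<exists>i. p ^ i dvd m \<and> x [^] (p ^ i) = \<one>"
proof -
  interpret U: group "units_of G" by (rule units_group)
  have "0 < p ^ k" using p by (simp add: prime_gt_0_nat)
  then have xU: "x \<in> Units G" using Units_if_pow_eq_one x pk by blast
  then have xc: "x \<in> carrier (units_of G)" by (simp add: units_of_carrier)
  have eq: "x [^] r = \<one> \<longleftrightarrow> U.ord x dvd r" for r :: nat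
    using U.pow_eq_id[OF xc, of r] units_of_pow[OF xU, of r] by (simp add: units_of_one)
  obtain i where "U.ord x = p ^ i"
    using pk p unfolding eq by (auto simp: divides_primepow_nat)
  then show ?thesis using m unfolding eq by (intro exI[of _ i]) simp
qed

text \<open>
  Squaring \<open>1 + y\<close> produces the cross term \<open>y + y = 0\<close>, where \<open>y\<close> is the power of \<open>x\<close> reached so far.
\<close>
lemma (in ring) freshman_dream_char_2:
  assumes two: "\<one> \<oplus> \<one> = \<zero>" and x: "x \<in> carrier R"
  shows "(\<one> \<oplus> x) [^] ((2::nat) ^ k) = \<one> \<oplus> x [^] ((2::nat) ^ k)"
proof (induction k)
  case 0
  then show ?case using x by simp
next
  case (Suc k)
  define y where "y = x [^] ((2::nat) ^ k)"
  have y: "y \<in> carrier R" using x by (simp add: y_def)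
  have yy: "y \<oplus> y = \<zero>"
  proof -
    have "y \<oplus> y = (\<one> \<oplus> \<one>) \<otimes> y" using y by (simp add: l_distr)
    then show ?thesis using y by (simp add: two)
  qed
  have sq: "(z [^] ((2::nat) ^ Suc k)) = z [^] ((2::nat) ^ k) \<otimes> z [^] ((2::nat) ^ k)"
    if "z \<in> carrier R" for z
    using that by (simp add: nat_pow_mult mult_2)
  have "(\<one> \<oplus> x) [^] ((2::nat) ^ Suc k) = (\<one> \<oplus> y) \<otimes> (\<one> \<oplus> y)"
    using x Suc.IH by (subst sq) (simp_all add: y_def)
  also have "\<dots> = \<one> \<oplus> (y \<oplus> y) \<oplus> y \<otimes> y"
    using y by (simp add: l_distr r_distr a_ac)
  also have "\<dots> = \<one> \<oplus> y \<otimes> y" using y by (simp add: yy)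
  also have "y \<otimes> y = x [^] ((2::nat) ^ Suc k)" using x by (subst sq) (simp_all add: y_def)
  finally show ?case .
qed

section \<open>Upper triangular matrices\<close>

lemma upper_triangular_mult:
  fixes A B :: "'a :: semiring_0 mat"
  assumes A: "A \<in> carrier_mat n n" "upper_triangular A"
    and B: "B \<in> carrier_mat n n" "upper_triangular B"
  shows "upper_triangular (A * B)"
proof
  fix i j assume ji: "j < i" and "i < dim_row (A * B)"
  then have i: "i < n" using A by simp
  have "A $$ (i,k) * B $$ (k,j) = 0" if "k < n" for k
    using upper_triangularD[OF A(2), of k i] upper_triangularD[OF B(2), of j k] A B ji i that
    by (cases "k < i") auto
  then show "(A * B) $$ (i,j) = 0"
    using A B ji i by (simp add: scalar_prod_def)
qed

lemma upper_triangular_mult_diag: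
  fixes A B :: "'a :: semiring_0 mat"
  assumes A: "A \<in> carrier_mat n n" "upper_triangular A"
    and B: "B \<in> carrier_mat n n" "upper_triangular B" and i: "i < n"
  shows "(A * B) $$ (i,i) = A $$ (i,i) * B $$ (i,i)"
proof -
  have "A $$ (i,k) * B $$ (k,i) = 0" if "k < n" "k \<noteq> i" for k
    using upper_triangularD[OF A(2), of k i] upper_triangularD[OF B(2), of i k] A B i that
    by (cases "k < i") auto
  then have "(\<Sum>k = 0..<n. A $$ (i,k) * B $$ (k,i)) =
      (\<Sum>k = 0..<n. if k = i then A $$ (i,i) * B $$ (i,i) else 0)"
    by (intro sum.cong) auto
  then show ?thesis using A B i by (simp add: scalar_prod_def)
qed

text \<open>
  Each factor \<open>N\<close> moves the support at least one diagonal further away from the main one.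
\<close>
lemma strictly_upper_triangular_pow_entry:
  fixes N :: "'a :: semiring_1 mat"
  assumes N: "N \<in> carrier_mat n n"
    and strict: "\<And>i j. i < n \<Longrightarrow> j \<le> i \<Longrightarrow> N $$ (i,j) = 0"
    and "i < n" "j < n" "j < i + k"
  shows "(N ^\<^sub>m k) $$ (i,j) = 0"
  using assms(3-)
proof (induction k arbitrary: i j)
  case 0
  then show ?case using N by simp
next
  case (Suc k)
  have "(N ^\<^sub>m k) $$ (i,l) * N $$ (l,j) = 0" if "l < n" for l
    using Suc that strict[of l j] by (cases "l < i + k") auto
  then show ?case using N Suc.prems by (simp add: scalar_prod_def)
qed

lemma strictly_upper_triangular_nilpotent:
  fixes N :: "'a :: semiring_1 mat"
  assumes "N \<in> carrier_mat n n"
    and "\<And>i j. i < n \<Longrightarrow> j \<le> i \<Longrightarrow> N $$ (i,j) = 0"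
    and "n \<le> k"
  shows "N ^\<^sub>m k = 0\<^sub>m n n"
  using assms by (intro eq_matI) (auto intro!: strictly_upper_triangular_pow_entry)

lemma upper_triangular_ring_simps:
  "carrier (upper_triangular_ring ty n) = {A \<in> carrier_mat n n. upper_triangular A}"
  "A \<otimes>\<^bsub>upper_triangular_ring ty n\<^esub> B = A * B"
  "A \<oplus>\<^bsub>upper_triangular_ring ty n\<^esub> B = A + B"
  "\<one>\<^bsub>upper_triangular_ring ty n\<^esub> = 1\<^sub>m n"
  "\<zero>\<^bsub>upper_triangular_ring ty n\<^esub> = 0\<^sub>m n n"
  by (simp_all add: upper_triangular_ring_def ring_mat_def)

lemma upper_triangular_ring_pow:
  fixes A :: "'a :: comm_ring_1 mat"
  assumes "A \<in> carrier_mat n n"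
  shows "A [^]\<^bsub>upper_triangular_ring TYPE('a) n\<^esub> (k::nat) = A ^\<^sub>m k"
  using assms by (induction k) (simp_all add: upper_triangular_ring_simps nat_pow_def)

lemma ring_upper_triangular_ring:
  "ring (upper_triangular_ring TYPE('a :: comm_ring_1) n)"
proof -
  interpret M: ring "ring_mat TYPE('a) n ()" by (rule ring_mat)
  have "subring {A \<in> carrier_mat n n. upper_triangular A} (ring_mat TYPE('a) n ())"
  proof (rule M.subringI)
    fix A :: "'a mat" assume A: "A \<in> {A \<in> carrier_mat n n. upper_triangular A}"
    have "\<ominus>\<^bsub>ring_mat TYPE('a) n ()\<^esub> A = - A"
      using A by (intro M.minus_equality) (auto simp: ring_mat_simps uminus_l_inv_mat)
    then show "\<ominus>\<^bsub>ring_mat TYPE('a) n ()\<^esub> A \<in> {A \<in> carrier_mat n n. upper_triangular A}"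
      using A by (auto simp: upper_triangular_def)
  next
    fix A B :: "'a mat"
    assume "A \<in> {A \<in> carrier_mat n n. upper_triangular A}"
      and "B \<in> {A \<in> carrier_mat n n. upper_triangular A}"
    then show "A \<oplus>\<^bsub>ring_mat TYPE('a) n ()\<^esub> B \<in> {A \<in> carrier_mat n n. upper_triangular A}"
      by (auto simp: ring_mat_simps upper_triangular_def)
  qed (auto simp: ring_mat_simps upper_triangular_mult)
  then show ?thesis unfolding upper_triangular_ring_def by (rule M.subring_is_ring)
qed

section \<open>Torsion cleanness over the field with two elements\<close>

abbreviation T2 :: "nat \<Rightarrow> bit mat ring" where
  "T2 n \<equiv> upper_triangular_ring TYPE(bit) n"

lemma unipotent_pow_eq_one:
  assumes U: "U \<in> carrier (T2 n)" and diag: "\<And>i. i < n \<Longrightarrow> U $$ (i,i) = 1"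
    and n: "n \<le> 2 ^ b"
  shows "U [^]\<^bsub>T2 n\<^esub> ((2::nat) ^ b) = \<one>\<^bsub>T2 n\<^esub>"
proof -
  interpret R: ring "T2 n" by (rule ring_upper_triangular_ring)
  define N where "N = U - 1\<^sub>m n"
  have N: "N \<in> carrier (T2 n)"
    using U by (auto simp: N_def upper_triangular_ring_simps upper_triangular_def)
  have strict: "N $$ (i,j) = 0" if "i < n" "j \<le> i" for i j
    using that U diag[of i] upper_triangularD[of U j i]
    by (cases "i = j") (auto simp: N_def upper_triangular_ring_simps)
  have "\<one>\<^bsub>T2 n\<^esub> \<oplus>\<^bsub>T2 n\<^esub> \<one>\<^bsub>T2 n\<^esub> = \<zero>\<^bsub>T2 n\<^esub>"
    by (auto simp: upper_triangular_ring_simps intro!: eq_matI)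
  moreover have "U = \<one>\<^bsub>T2 n\<^esub> \<oplus>\<^bsub>T2 n\<^esub> N"
    using U by (auto simp: N_def upper_triangular_ring_simps intro!: eq_matI)
  moreover have "N [^]\<^bsub>T2 n\<^esub> ((2::nat) ^ b) = \<zero>\<^bsub>T2 n\<^esub>"
    using N strict n
    by (simp add: upper_triangular_ring_pow upper_triangular_ring_simps
        strictly_upper_triangular_nilpotent)
  ultimately show ?thesis using R.freshman_dream_char_2 N by simp
qed

text \<open>
  The diagonal of the idempotent has to be the complement of the diagonal of \<open>r\<close>, since the unit
  must have ones there; the diagonal matrix with these entries is already idempotent.
\<close>
lemma almost_torsion_clean_two_power:
  assumes "0 < n" and n: "n \<le> 2 ^ b"
  shows "almost_torsion_clean (T2 n) (2 ^ b)"
proof -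
  interpret R: ring "T2 n" by (rule ring_upper_triangular_ring)
  have "\<exists>u \<in> Units (T2 n). \<exists>e \<in> carrier (T2 n). u [^]\<^bsub>T2 n\<^esub> ((2::nat) ^ b) = \<one>\<^bsub>T2 n\<^esub>
      \<and> e \<otimes>\<^bsub>T2 n\<^esub> e = e \<and> r = u \<oplus>\<^bsub>T2 n\<^esub> e" if r: "r \<in> carrier (T2 n)" for r
  proof -
    define e where "e = mat n n (\<lambda>(i,j). if i = j then r $$ (i,i) + 1 else 0)"
    have e: "e \<in> carrier (T2 n)"
      by (auto simp: e_def upper_triangular_ring_simps)
    have u: "r - e \<in> carrier (T2 n)"
      using r by (auto simp: e_def upper_triangular_ring_simps upper_triangular_def)
    have "(r - e) $$ (i,i) = 1" if "i < n" for i
      using that r by (cases "r $$ (i,i)") (auto simp: e_def upper_triangular_ring_simps)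
    then have pow: "(r - e) [^]\<^bsub>T2 n\<^esub> ((2::nat) ^ b) = \<one>\<^bsub>T2 n\<^esub>"
      using unipotent_pow_eq_one u n by blast
    have "(e * e) $$ (i,j) = e $$ (i,j)" if "i < n" "j < n" for i j
    proof -
      have "(\<Sum>k = 0..<n. e $$ (i,k) * e $$ (k,j)) =
          (\<Sum>k = 0..<n. if k = i then e $$ (i,j) else 0)"
        using that by (intro sum.cong) (auto simp: e_def)
      then show ?thesis using that by (simp add: scalar_prod_def e_def)
    qed
    then have idem: "e \<otimes>\<^bsub>T2 n\<^esub> e = e"
      by (auto simp: upper_triangular_ring_simps e_def intro!: eq_matI)
    have "r = (r - e) \<oplus>\<^bsub>T2 n\<^esub> e"
      using r by (auto simp: upper_triangular_ring_simps e_def intro!: eq_matI)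
    moreover have "r - e \<in> Units (T2 n)"
      using R.Units_if_pow_eq_one u pow by simp
    ultimately show ?thesis using e idem pow by blast
  qed
  moreover have "\<one>\<^bsub>T2 n\<^esub> \<noteq> \<zero>\<^bsub>T2 n\<^esub>"
  proof
    assume "\<one>\<^bsub>T2 n\<^esub> = \<zero>\<^bsub>T2 n\<^esub>"
    then have "1\<^sub>m n $$ (0,0) = (0\<^sub>m n n $$ (0,0) :: bit)"
      by (simp add: upper_triangular_ring_simps)
    then show False using \<open>0 < n\<close> by simp
  qed
  ultimately show ?thesis
    using R.ring_axioms by (simp add: almost_torsion_clean_def)
qed

text \<open>
  The Jordan block with eigenvalue 1 has only the trivial decomposition into a unit and an
  idempotent, so its order, a power of two that is at least \<open>n\<close>, divides every admissible exponent.
\<close>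
lemma almost_torsion_clean_imp_two_power_dvd:
  assumes "almost_torsion_clean (T2 n) m"
  shows "\<exists>i. 2 ^ i dvd m \<and> n \<le> 2 ^ i"
proof -
  interpret R: ring "T2 n" by (rule ring_upper_triangular_ring)
  define J :: "bit mat" where "J = jordan_block n 1"
  have J: "J \<in> carrier (T2 n)"
    by (auto simp: J_def upper_triangular_ring_simps)
  have diagJ: "J $$ (i,i) = 1" if "i < n" for i
    using that by (simp add: J_def)
  obtain u e where uU: "u \<in> Units (T2 n)" and e: "e \<in> carrier (T2 n)"
    and um: "u [^]\<^bsub>T2 n\<^esub> m = \<one>\<^bsub>T2 n\<^esub>"
    and idem: "e \<otimes>\<^bsub>T2 n\<^esub> e = e" and Jue: "J = u \<oplus>\<^bsub>T2 n\<^esub> e"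
    using assms J unfolding almost_torsion_clean_def by blast
  obtain v where u: "u \<in> carrier (T2 n)" and v: "v \<in> carrier (T2 n)"
    and uv: "u \<otimes>\<^bsub>T2 n\<^esub> v = \<one>\<^bsub>T2 n\<^esub>"
    using uU by (auto simp: Units_def)
  have diag_e: "e $$ (i,i) = 0" if i: "i < n" for i
  proof -
    have "u $$ (i,i) * v $$ (i,i) = (u * v) $$ (i,i)"
      using u v i by (intro upper_triangular_mult_diag[symmetric])
        (auto simp: upper_triangular_ring_simps)
    also have "\<dots> = 1" using uv i by (simp add: upper_triangular_ring_simps)
    finally have "u $$ (i,i) = 1" by (cases "u $$ (i,i)") auto
    moreover have "u $$ (i,i) + e $$ (i,i) = (u + e) $$ (i,i)"
      using e i by (auto simp: upper_triangular_ring_simps)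
    then have "u $$ (i,i) + e $$ (i,i) = 1"
      using diagJ[OF i] Jue by (simp add: upper_triangular_ring_simps)
    ultimately show ?thesis by (cases "e $$ (i,i)") auto
  qed
  have "e $$ (i,j) = 0" if "i < n" "j \<le> i" for i j
    using that e diag_e[of i] upper_triangularD[of e j i]
    by (cases "i = j") (auto simp: upper_triangular_ring_simps)
  \<comment> \<open>The exponent is a successor so that idempotence applies even to the empty matrix.\<close>
  then have "e ^\<^sub>m Suc n = 0\<^sub>m n n"
    using e by (intro strictly_upper_triangular_nilpotent) (auto simp: upper_triangular_ring_simps)
  moreover have "e [^]\<^bsub>T2 n\<^esub> Suc k = e" for k
    using e idem by (induction k) simp_all
  ultimately have "e = 0\<^sub>m n n"
    using e upper_triangular_ring_pow[of e n "Suc n"] by (simp add: upper_triangular_ring_simps)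
  then have "J = u" using Jue u by (simp add: upper_triangular_ring_simps)
  then have Jm: "J [^]\<^bsub>T2 n\<^esub> m = \<one>\<^bsub>T2 n\<^esub>" using um by simp
  have "n \<le> 2 ^ n" using less_exp[of n] by simp
  then have "J [^]\<^bsub>T2 n\<^esub> ((2::nat) ^ n) = \<one>\<^bsub>T2 n\<^esub>"
    using unipotent_pow_eq_one J diagJ by blast
  then obtain i where i: "2 ^ i dvd m" and Ji: "J [^]\<^bsub>T2 n\<^esub> ((2::nat) ^ i) = \<one>\<^bsub>T2 n\<^esub>"
    using R.common_pow_eq_one_prime_power[OF J two_is_prime_nat Jm] by blast
  have "n \<le> 2 ^ i"
  proof (rule ccontr)
    assume "\<not> n \<le> 2 ^ i"
    then have lt: "2 ^ i < n" by simp
    \<comment> \<open>The entry is the binomial coefficient \<open>2 ^ i choose 2 ^ i\<close>.\<close>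
    have "(J ^\<^sub>m (2 ^ i)) $$ (0, 2 ^ i) = 1"
      using lt unfolding J_def jordan_block_pow by simp
    moreover have "J ^\<^sub>m (2 ^ i) = 1\<^sub>m n"
      using Ji J by (simp add: upper_triangular_ring_pow upper_triangular_ring_simps)
    ultimately show False using lt by simp
  qed
  then show ?thesis using i by blast
qed

theorem theorem2p17:
  fixes n :: nat
  assumes "n > 2"
  shows "torsion_clean (upper_triangular_ring TYPE(bit) n) n \<longleftrightarrow> (\<exists>l::nat. l \<ge> 2 \<and> n = 2 ^ l)"
proof
  assume "torsion_clean (T2 n) n"
  then obtain l where "2 ^ l dvd n" "n \<le> 2 ^ l"
    using almost_torsion_clean_imp_two_power_dvd unfolding torsion_clean_def by blast
  then have l: "n = 2 ^ l" using assms by (simp add: dvd_imp_le le_antisym)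
  have "l \<ge> 2"
  proof (rule ccontr)
    assume "\<not> l \<ge> 2"
    then have "l = 0 \<or> l = 1" by linarith
    then show False using l assms by auto
  qed
  then show "\<exists>l\<ge>2. n = 2 ^ l" using l by blast
next
  assume "\<exists>l\<ge>2. n = 2 ^ l"
  then obtain l where l: "n = 2 ^ l" by blast
  have "almost_torsion_clean (T2 n) (2 ^ l)"
    using assms l by (intro almost_torsion_clean_two_power) simp_all
  then have "almost_torsion_clean (T2 n) n" by (simp add: l)
  moreover have "\<not> almost_torsion_clean (T2 n) m" if "0 < m" "m < n" for m
  proof
    assume "almost_torsion_clean (T2 n) m"
    then obtain i where "2 ^ i dvd m" "n \<le> 2 ^ i"
      using almost_torsion_clean_imp_two_power_dvd by blast
    then show False using that dvd_imp_le[of "2 ^ i" m] by simp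
  qed
  ultimately show "torsion_clean (T2 n) n" by (simp add: torsion_clean_def)
qed

end
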